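(* Let $g\in\mathbb{R}^T$. The CSP $A^*(g)$ is satisfiable if and only if $B(g)\le B(f)$ for every $f\in g+M^*$.
   Context: Fix a structure $(D,V,C)$: $V$ is a finite set of variables, $D$ a finite nonempty domain, $C\subseteq 2^V$ a set of non-empty subsets of $V$ (scopes). For $S\subseteq V$, $D^S$ is the set of maps $S\to D$; for an assignment $x\in D^V$, $x[S]\in D^S$ is its restriction to $S$. Tuples: $T_S=\{(S,k)\mid k\in D^S\}$ for $S\in C$ and $T=\bigcup_{S\in C}T_S$. A CSP is a subset $A\subseteq T$ (of allowed tuples); $x\in D^V$ is a solution of $A$ if $(S,x[S])\in A$ for all $S\in C$; $A$ is satisfiable if it has a solution. A WCSP is a vector $f\in\mathbb{R}^T$. The map $\phi\colon D^V\to\{0,1\}^T$ is defined by $\phi_{(S,k)}(x)=1$ if $x[S]=k$ and $0$ otherwise, so $\langle f,\phi(x)\rangle=\sum_{S\in C}f_{(S,x[S])}$. Let $M^*=\{d\in\mathbb{R}^T\mid \langle d,\phi(x)\rangle\ge 0\ \forall x\in D^V\}$ and $g+M^*=\{g+d\mid d\in M^*\}$ (the set of super-reparametrizations of $g$). Upper bound: $B(f)=\sum_{S\in C}\max_{t\in T_S}f_t$. A tuple $t\in T_S$ is active for $f$ if $f_t=\max_{t'\in T_S}f_{t'}$; $A^*(f)\subseteq T$ is the set of all tuples active for $f$, viewed as a CSP. *)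

theory Defs
  imports Complex_Main "HOL-Library.FuncSet"
begin

text \<open>
  The sets D^S of assignments are rendered as the extensional function spaces
  \<open>S \<rightarrow>\<^sub>E D\<close>, so x[S] is \<open>restrict x S\<close>. Likewise real vectors indexed by
  T are the elements of \<open>T \<rightarrow>\<^sub>E UNIV\<close>.
\<close>

type_synonym ('v, 'd) tup = "'v set \<times> ('v \<Rightarrow> 'd)"

locale csp_structure =
  fixes D :: "'d set" and V :: "'v set" and C :: "'v set set"
  assumes finite_V: "finite V"
    and finite_D: "finite D"
    and D_nonempty: "D \<noteq> {}"
    and scopes_subset: "C \<subseteq> Pow V"
    and scopes_nonempty: "{} \<notin> C"

definition scope_tuples :: "'d set \<Rightarrow> 'v set \<Rightarrow> ('v, 'd) tup set" where
  "scope_tuples D S = {(S, k) | k. k \<in> S \<rightarrow>\<^sub>E D}"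

definition tuples :: "'d set \<Rightarrow> 'v set set \<Rightarrow> ('v, 'd) tup set" where
  "tuples D C = (\<Union>S\<in>C. scope_tuples D S)"

definition is_solution ::
  "'d set \<Rightarrow> 'v set \<Rightarrow> 'v set set \<Rightarrow> ('v, 'd) tup set \<Rightarrow> ('v \<Rightarrow> 'd) \<Rightarrow> bool" where
  "is_solution D V C A x \<longleftrightarrow> x \<in> V \<rightarrow>\<^sub>E D \<and> (\<forall>S\<in>C. (S, restrict x S) \<in> A)"

definition satisfiable ::
  "'d set \<Rightarrow> 'v set \<Rightarrow> 'v set set \<Rightarrow> ('v, 'd) tup set \<Rightarrow> bool" where
  "satisfiable D V C A \<longleftrightarrow> (\<exists>x. is_solution D V C A x)"

definition wcsps :: "'d set \<Rightarrow> 'v set set \<Rightarrow> (('v, 'd) tup \<Rightarrow> real) set" where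
  "wcsps D C = tuples D C \<rightarrow>\<^sub>E UNIV"

definition wcsp_add ::
  "'d set \<Rightarrow> 'v set set \<Rightarrow> (('v, 'd) tup \<Rightarrow> real) \<Rightarrow> (('v, 'd) tup \<Rightarrow> real) \<Rightarrow>
    ('v, 'd) tup \<Rightarrow> real" where
  "wcsp_add D C f g = (\<lambda>t\<in>tuples D C. f t + g t)"

definition wcsp_inner ::
  "'d set \<Rightarrow> 'v set set \<Rightarrow> (('v, 'd) tup \<Rightarrow> real) \<Rightarrow> (('v, 'd) tup \<Rightarrow> real) \<Rightarrow> real" where
  "wcsp_inner D C f g = (\<Sum>t\<in>tuples D C. f t * g t)"

definition phi :: "'d set \<Rightarrow> 'v set set \<Rightarrow> ('v \<Rightarrow> 'd) \<Rightarrow> ('v, 'd) tup \<Rightarrow> real" where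
  "phi D C x = (\<lambda>(S, k)\<in>tuples D C. if restrict x S = k then 1 else 0)"

definition M_dual :: "'d set \<Rightarrow> 'v set \<Rightarrow> 'v set set \<Rightarrow> (('v, 'd) tup \<Rightarrow> real) set" where
  "M_dual D V C = {d \<in> wcsps D C. \<forall>x \<in> V \<rightarrow>\<^sub>E D. wcsp_inner D C d (phi D C x) \<ge> 0}"

definition super_reparametrizations ::
  "'d set \<Rightarrow> 'v set \<Rightarrow> 'v set set \<Rightarrow> (('v, 'd) tup \<Rightarrow> real) \<Rightarrow> (('v, 'd) tup \<Rightarrow> real) set" where
  "super_reparametrizations D V C g = {wcsp_add D C g d | d. d \<in> M_dual D V C}"

definition upper_bound :: "'d set \<Rightarrow> 'v set set \<Rightarrow> (('v, 'd) tup \<Rightarrow> real) \<Rightarrow> real" where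
  "upper_bound D C f = (\<Sum>S\<in>C. Max (f ` scope_tuples D S))"

definition active_tuples ::
  "'d set \<Rightarrow> 'v set set \<Rightarrow> (('v, 'd) tup \<Rightarrow> real) \<Rightarrow> ('v, 'd) tup set" where
  "active_tuples D C f = (\<Union>S\<in>C. {t \<in> scope_tuples D S. f t = Max (f ` scope_tuples D S)})"

lemma (in csp_structure) wcsp_inner_phi:
  assumes x: "x \<in> V \<rightarrow>\<^sub>E D"
  shows "wcsp_inner D C f (phi D C x) = (\<Sum>S\<in>C. f (S, restrict x S))"
proof -
  have finC: "finite C"
    using finite_V scopes_subset by (meson finite_Pow_iff finite_subset)
  have finS: "finite (S \<rightarrow>\<^sub>E D)" if "S \<in> C" for S
    using that finite_V finite_D scopes_subset by (meson PowD finite_PiE finite_subset subsetD)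
  have T: "tuples D C = Sigma C (\<lambda>S. S \<rightarrow>\<^sub>E D)"
    by (auto simp: tuples_def scope_tuples_def)
  have xS: "restrict x S \<in> S \<rightarrow>\<^sub>E D" if "S \<in> C" for S
    using that x scopes_subset by (auto simp: PiE_iff)
  have "wcsp_inner D C f (phi D C x)
      = (\<Sum>(S, k)\<in>Sigma C (\<lambda>S. S \<rightarrow>\<^sub>E D). if restrict x S = k then f (S, k) else 0)"
    unfolding wcsp_inner_def phi_def T by (rule sum.cong) auto
  also have "\<dots> = (\<Sum>S\<in>C. \<Sum>k\<in>S \<rightarrow>\<^sub>E D. if restrict x S = k then f (S, k) else 0)"
    using finC finS by (subst sum.Sigma) auto
  also have "\<dots> = (\<Sum>S\<in>C. f (S, restrict x S))"
    using finS xS by (intro sum.cong refl) (simp add: sum.delta)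
  finally show ?thesis .
qed

end

theory Submission
  imports Defs
begin

text \<open>
  The constant vector \<open>M / \<bar>C\<bar>\<close> on T is a super-reparametrization of g exactly when M bounds
  all \<open>\<langle>g, \<phi>(x)\<rangle>\<close> from above, and its own upper bound is M.
  Hence the least upper bound over \<open>g + M\<^sup>*\<close> is the maximum of \<open>\<langle>g, \<phi>(x)\<rangle>\<close>, and that
  maximum reaches \<open>B(g)\<close> only at an x all of whose tuples are active.
\<close>

context csp_structure
begin

lemma finite_C: "finite C"
  using finite_V scopes_subset by (meson finite_Pow_iff finite_subset)

lemma finite_scope_tuples:
  assumes "S \<in> C"
  shows "finite (scope_tuples D S)"
proof -
  have "finite S"
    using assms finite_V scopes_subset by (auto intro: finite_subset)
  then show ?thesis
    using finite_D by (simp add: scope_tuples_def setcompr_eq_image finite_PiE)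
qed

lemma scope_tuples_nonempty: "scope_tuples D S \<noteq> {}"
  using D_nonempty by (auto simp: scope_tuples_def PiE_eq_empty_iff)

lemma restrict_in_scope_tuples:
  assumes "x \<in> V \<rightarrow>\<^sub>E D" "S \<in> C"
  shows "(S, restrict x S) \<in> scope_tuples D S"
  using assms scopes_subset by (auto simp: scope_tuples_def PiE_iff)

lemma le_Max_scope_tuples:
  assumes "x \<in> V \<rightarrow>\<^sub>E D" "S \<in> C"
  shows "f (S, restrict x S) \<le> Max (f ` scope_tuples D S)"
  using assms by (intro Max_ge finite_imageI imageI finite_scope_tuples restrict_in_scope_tuples)

lemma is_solution_active_tuples_iff:
  assumes "x \<in> V \<rightarrow>\<^sub>E D"
  shows "is_solution D V C (active_tuples D C f) x \<longleftrightarrow>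
    (\<forall>S\<in>C. f (S, restrict x S) = Max (f ` scope_tuples D S))"
  using assms restrict_in_scope_tuples[OF assms]
  by (auto simp: is_solution_def active_tuples_def scope_tuples_def)

lemma wcsp_inner_phi_le_upper_bound:
  assumes "x \<in> V \<rightarrow>\<^sub>E D"
  shows "wcsp_inner D C f (phi D C x) \<le> upper_bound D C f"
  using assms by (auto simp: wcsp_inner_phi upper_bound_def intro!: sum_mono le_Max_scope_tuples)

text \<open>\<open>wcsp_inner_phi\<close> turns the right-hand side into a comparison of two sums
  over \<open>C\<close> whose summands satisfy \<le> scope by scope. The sums can agree only if
  every scope attains its maximum, that is, if all tuples of x are active.\<close>

lemma is_solution_active_tuples_iff_upper_bound:
  assumes x: "x \<in> V \<rightarrow>\<^sub>E D"
  shows "is_solution D V C (active_tuples D C f) x \<longleftrightarrow>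
    upper_bound D C f \<le> wcsp_inner D C f (phi D C x)"
proof
  assume "is_solution D V C (active_tuples D C f) x"
  then show "upper_bound D C f \<le> wcsp_inner D C f (phi D C x)"
    using x by (simp add: is_solution_active_tuples_iff wcsp_inner_phi upper_bound_def)
next
  assume "upper_bound D C f \<le> wcsp_inner D C f (phi D C x)"
  \<comment> \<open>The opposite inequality holds for every assignment, so the assumed one is an
    equality.\<close>
  then have eq: "(\<Sum>S\<in>C. f (S, restrict x S)) = (\<Sum>S\<in>C. Max (f ` scope_tuples D S))"
    using wcsp_inner_phi_le_upper_bound[OF x, of f] x
    by (simp add: wcsp_inner_phi upper_bound_def)
  show "is_solution D V C (active_tuples D C f) x"
    unfolding is_solution_active_tuples_iff[OF x]
    using sum_mono_inv[OF eq le_Max_scope_tuples[OF x] _ finite_C] by blast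
qed

lemma wcsp_inner_add_left:
  "wcsp_inner D C (wcsp_add D C f g) h = wcsp_inner D C f h + wcsp_inner D C g h"
  by (simp add: wcsp_inner_def wcsp_add_def sum.distrib distrib_right)

text \<open>The inner product is additive in its first argument, so the condition that
  \<open>M_dual\<close> puts on the difference of f and g says that f dominates g on every
  assignment.\<close>

lemma super_reparametrizations_iff:
  assumes "g \<in> wcsps D C"
  shows "f \<in> super_reparametrizations D V C g \<longleftrightarrow> f \<in> wcsps D C \<and>
    (\<forall>x \<in> V \<rightarrow>\<^sub>E D. wcsp_inner D C g (phi D C x) \<le> wcsp_inner D C f (phi D C x))"
proof (intro iffI conjI ballI)
  assume "f \<in> super_reparametrizations D V C g"
  then obtain d where d: "d \<in> M_dual D V C" and f: "f = wcsp_add D C g d"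
    by (auto simp: super_reparametrizations_def)
  show "f \<in> wcsps D C"
    by (simp add: f wcsps_def wcsp_add_def)
  fix x assume "x \<in> V \<rightarrow>\<^sub>E D"
  then show "wcsp_inner D C g (phi D C x) \<le> wcsp_inner D C f (phi D C x)"
    using d by (simp add: f wcsp_inner_add_left M_dual_def)
next
  assume f: "f \<in> wcsps D C \<and>
    (\<forall>x \<in> V \<rightarrow>\<^sub>E D. wcsp_inner D C g (phi D C x) \<le> wcsp_inner D C f (phi D C x))"
  define d where "d = (\<lambda>t\<in>tuples D C. f t - g t)"
  have eq: "f = wcsp_add D C g d"
    \<comment> \<open>Both sides are \<open>undefined\<close> outside \<open>tuples D C\<close>, so
      agreement on the tuples gives equality of functions.\<close>
    using f by (auto simp: d_def wcsp_add_def wcsps_def PiE_iff extensional_def)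
  have "d \<in> wcsps D C"
    by (simp add: d_def wcsps_def)
  moreover have "0 \<le> wcsp_inner D C d (phi D C x)" if "x \<in> V \<rightarrow>\<^sub>E D" for x
    using f that wcsp_inner_add_left[of g d "phi D C x", folded eq] by force
  ultimately show "f \<in> super_reparametrizations D V C g"
    using eq by (auto simp: super_reparametrizations_def M_dual_def)
qed

text \<open>Spread M evenly over the scopes: an assignment selects exactly one tuple per scope, so
  it collects \<open>card C\<close> shares of \<open>M / card C\<close>. A scope must exist for
  these shares to add up to M.\<close>

lemma obtain_constant_wcsp:
  assumes "C \<noteq> {}"
  obtains f where "f \<in> wcsps D C" "upper_bound D C f = M"
    "\<And>x. x \<in> V \<rightarrow>\<^sub>E D \<Longrightarrow> wcsp_inner D C f (phi D C x) = M"
proof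
  let ?f = "\<lambda>t\<in>tuples D C. M / card C"
  have const: "?f t = M / card C" if "S \<in> C" "t \<in> scope_tuples D S" for S t
    using that by (auto simp: tuples_def)
  have "card C \<noteq> 0"
    using assms finite_C by simp
  then have M: "(\<Sum>S\<in>C. M / card C) = M"
    by simp
  show "?f \<in> wcsps D C"
    by (simp add: wcsps_def)
  \<comment> \<open>Since the scope has at least one tuple, the image is a singleton and its maximum
    is the constant.\<close>
  have "?f ` scope_tuples D S = {M / card C}" if "S \<in> C" for S
    using const[OF that] scope_tuples_nonempty[of S] by (simp add: image_constant_conv cong: image_cong)
  then have "upper_bound D C ?f = (\<Sum>S\<in>C. M / card C)"
    unfolding upper_bound_def by (intro sum.cong) auto
  with M show "upper_bound D C ?f = M"
    by simp
  fix x assume x: "x \<in> V \<rightarrow>\<^sub>E D"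
  have "wcsp_inner D C ?f (phi D C x) = (\<Sum>S\<in>C. M / card C)"
    unfolding wcsp_inner_phi[OF x]
    using const[OF _ restrict_in_scope_tuples[OF x]] by (intro sum.cong refl) blast
  with M show "wcsp_inner D C ?f (phi D C x) = M"
    by simp
qed

lemma obtain_optimal_assignment:
  obtains x where "x \<in> V \<rightarrow>\<^sub>E D"
    "\<And>y. y \<in> V \<rightarrow>\<^sub>E D \<Longrightarrow> wcsp_inner D C g (phi D C y) \<le> wcsp_inner D C g (phi D C x)"
proof -
  let ?X = "V \<rightarrow>\<^sub>E D" and ?v = "\<lambda>x. wcsp_inner D C g (phi D C x)"
  have fin: "finite (?v ` ?X)" and "?v ` ?X \<noteq> {}"
    using finite_V finite_D D_nonempty by (auto simp: PiE_eq_empty_iff intro: finite_PiE)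
  then have "Max (?v ` ?X) \<in> ?v ` ?X"
    by (rule Max_in)
  then obtain x where "x \<in> ?X" "?v x = Max (?v ` ?X)"
    by auto
  with that fin show ?thesis
    by simp
qed

end

theorem theorem3:
  fixes D :: "'d set" and V :: "'v set" and C :: "'v set set"
    and g :: "('v, 'd) tup \<Rightarrow> real"
  assumes "csp_structure D V C"
    and "g \<in> wcsps D C"
  shows "satisfiable D V C (active_tuples D C g) \<longleftrightarrow>
    (\<forall>f \<in> super_reparametrizations D V C g. upper_bound D C g \<le> upper_bound D C f)"
proof -
  interpret csp_structure D V C by fact
  show ?thesis
  proof (intro iffI ballI)
    fix f
    assume "satisfiable D V C (active_tuples D C g)"
    then obtain x where sol: "is_solution D V C (active_tuples D C g) x"
      and x: "x \<in> V \<rightarrow>\<^sub>E D"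
      by (auto simp: satisfiable_def is_solution_def)
    assume "f \<in> super_reparametrizations D V C g"
    then have "wcsp_inner D C g (phi D C x) \<le> wcsp_inner D C f (phi D C x)"
      using x by (simp add: super_reparametrizations_iff[OF assms(2)])
    \<comment> \<open>The chain is B(g) \<le> value of g at x \<le> value of f at x \<le> B(f); the
      first step holds because x is a solution.\<close>
    then show "upper_bound D C g \<le> upper_bound D C f"
      using sol wcsp_inner_phi_le_upper_bound[OF x, of f]
      by (simp add: is_solution_active_tuples_iff_upper_bound[OF x])
  next
    assume bound: "\<forall>f \<in> super_reparametrizations D V C g. upper_bound D C g \<le> upper_bound D C f"
    obtain x where x: "x \<in> V \<rightarrow>\<^sub>E D"
      and opt: "\<And>y. y \<in> V \<rightarrow>\<^sub>E D \<Longrightarrow>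
        wcsp_inner D C g (phi D C y) \<le> wcsp_inner D C g (phi D C x)"
      using obtain_optimal_assignment by blast
    have "upper_bound D C g \<le> wcsp_inner D C g (phi D C x)"
    \<comment> \<open>Without scopes there is nothing to spread a constant over, but then both sides
      are empty sums.\<close>
    proof (cases "C = {}")
      case True
      then show ?thesis
        using wcsp_inner_phi[OF x, of g] by (simp add: upper_bound_def)
    next
      case False
      then obtain f where f: "f \<in> wcsps D C"
        and B: "upper_bound D C f = wcsp_inner D C g (phi D C x)"
        and val: "\<And>y. y \<in> V \<rightarrow>\<^sub>E D \<Longrightarrow>
          wcsp_inner D C f (phi D C y) = wcsp_inner D C g (phi D C x)"
        using obtain_constant_wcsp by blast
      \<comment> \<open>By \<open>val\<close>, f takes the optimal value of g at every assignment,
        so by \<open>opt\<close> it dominates g.\<close>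
      have "f \<in> super_reparametrizations D V C g"
        using f val opt by (simp add: super_reparametrizations_iff[OF assms(2)])
      with bound B show ?thesis
        by force
    qed
    \<comment> \<open>The optimal x attains B(g), hence is itself a solution.\<close>
    then show "satisfiable D V C (active_tuples D C g)"
      using is_solution_active_tuples_iff_upper_bound[OF x] by (auto simp: satisfiable_def)
  qed
qed

end
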